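(* Let $G=(V,E)$ be an infinite, locally finite, connected graph without loops or multiple edges. Suppose that there is a vertex $x_0\in V$ such that $\underline{m}_{+1}(r)=\min_{x\in S_r(x_0)}m_{+1}(x)$ and $\overline{m}_{-1}(r)=\max_{x\in S_r(x_0)}m_{-1}(x)$ satisfy $\underline{m}_{+1}(r)>0$ for all $r\ge 1$ and $$\sum_{r=1}^\infty \frac{\overline{m}_{-1}(r)}{\underline{m}_{+1}(r)}<\infty .$$ Then $G$ is stochastically incomplete.
   Context: $d(x,y)$ is the number of edges in a shortest path from $x$ to $y$; $S_r(x_0)=\{x\in V: d(x,x_0)=r\}$. For $x\in S_r(x_0)$, $m_{\pm1}(x)=|\{y\sim x : y\in S_{r\pm1}(x_0)\}|$ is the number of neighbors of $x$ in the next (respectively previous) sphere. Laplacian: $\Delta f(x)=\sum_{y\sim x}(f(x)-f(y))$ for $f:V\to\mathbf{R}$. Heat kernel: fix a vertex $o\in V$. For $r\ge 0$ let $B_r$ be the subgraph induced on the vertices at distance at most $r$ from $o$; $\mathrm{int}\,B_r$ is the set of vertices of $B_r$ all of whose neighbors in $G$ lie in $B_r$, and $\partial B_r$ is the set of remaining vertices of $B_r$. Let $C(B_r,\partial B_r)$ be the finite-dimensional space of real functions on $B_r$ vanishing on $\partial B_r$, and let $\Delta_r$ act on it by $\Delta_r f(x)=\Delta f(x)$ for $x\in \mathrm{int}\,B_r$ and $\Delta_r f(x)=0$ for $x \in \partial B_r$. For $t\ge 0$ put $p_t^r(x,y)=e^{-t\Delta_r}\delta_x(y)$ for $x,y\in\mathrm{int}\,B_r$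 and $p_t^r(x,y)=0$ for all other pairs of vertices. The heat kernel of $G$ is $p_t(x,y)=\lim_{r\to\infty}p_t^r(x,y)$ (the limit exists and does not depend on $o$). Equivalently, $p_t(x,y)$ is the smallest non-negative function satisfying $\Delta p_t(x,y)+\frac{\partial}{\partial t}p_t(x,y)=0$ for $t \geq 0$ and $p_0(x,y)=\delta_x(y)$. One has $\sum_{y\in V}p_t(x,y)\le 1$. $G$ is stochastically incomplete if $\sum_{y\in V}p_t(x,y)<1$ for some $x\in V$ and some $t>0$. *)

theory Defs
  imports "HOL-Analysis.Analysis"
begin

(* A graph is a vertex set V with an adjacency relation E; the relation excludes multiple edges. *)

locale simple_graph =
  fixes V :: "'a set" and E :: "'a \<Rightarrow> 'a \<Rightarrow> bool"
  assumes adj_in_V: "E x y \<Longrightarrow> x \<in> V \<and> y \<in> V"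
    and adj_sym: "E x y \<Longrightarrow> E y x"
    and adj_irrefl: "\<not> E x x"

definition nbrs :: "'a set \<Rightarrow> ('a \<Rightarrow> 'a \<Rightarrow> bool) \<Rightarrow> 'a \<Rightarrow> 'a set" where
  "nbrs V E x = {y \<in> V. E x y}"

definition locally_finite :: "'a set \<Rightarrow> ('a \<Rightarrow> 'a \<Rightarrow> bool) \<Rightarrow> bool" where
  "locally_finite V E \<longleftrightarrow> (\<forall>x\<in>V. finite (nbrs V E x))"

definition connected_graph :: "'a set \<Rightarrow> ('a \<Rightarrow> 'a \<Rightarrow> bool) \<Rightarrow> bool" where
  "connected_graph V E \<longleftrightarrow> (\<forall>x\<in>V. \<forall>y\<in>V. E\<^sup>*\<^sup>* x y)"

(* The relation power (E ^^ n) x y says that n consecutive edges lead from x to y.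
   The value is meaningful only if x and y are joined by a path. *)
definition gdist :: "('a \<Rightarrow> 'a \<Rightarrow> bool) \<Rightarrow> 'a \<Rightarrow> 'a \<Rightarrow> nat" where
  "gdist E x y = (LEAST n. (E ^^ n) x y)"

definition gsphere :: "'a set \<Rightarrow> ('a \<Rightarrow> 'a \<Rightarrow> bool) \<Rightarrow> 'a \<Rightarrow> nat \<Rightarrow> 'a set" where
  "gsphere V E x0 r = {x \<in> V. gdist E x x0 = r}"

definition m_plus :: "'a set \<Rightarrow> ('a \<Rightarrow> 'a \<Rightarrow> bool) \<Rightarrow> 'a \<Rightarrow> 'a \<Rightarrow> nat" where
  "m_plus V E x0 x = card {y \<in> nbrs V E x. gdist E y x0 = Suc (gdist E x x0)}"

definition m_minus :: "'a set \<Rightarrow> ('a \<Rightarrow> 'a \<Rightarrow> bool) \<Rightarrow> 'a \<Rightarrow> 'a \<Rightarrow> nat" where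
  "m_minus V E x0 x = card {y \<in> nbrs V E x. Suc (gdist E y x0) = gdist E x x0}"

(* In an infinite, locally finite, connected graph every sphere is finite and nonempty,
   so that Min and Max are the true extrema. *)

definition m_plus_min :: "'a set \<Rightarrow> ('a \<Rightarrow> 'a \<Rightarrow> bool) \<Rightarrow> 'a \<Rightarrow> nat \<Rightarrow> nat" where
  "m_plus_min V E x0 r = Min (m_plus V E x0 ` gsphere V E x0 r)"

definition m_minus_max :: "'a set \<Rightarrow> ('a \<Rightarrow> 'a \<Rightarrow> bool) \<Rightarrow> 'a \<Rightarrow> nat \<Rightarrow> nat" where
  "m_minus_max V E x0 r = Max (m_minus V E x0 ` gsphere V E x0 r)"

definition laplacian ::
  "'a set \<Rightarrow> ('a \<Rightarrow> 'a \<Rightarrow> bool) \<Rightarrow> ('a \<Rightarrow> real) \<Rightarrow> 'a \<Rightarrow> real" where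
  "laplacian V E f x = (\<Sum>y\<in>nbrs V E x. f x - f y)"

definition gball :: "'a set \<Rightarrow> ('a \<Rightarrow> 'a \<Rightarrow> bool) \<Rightarrow> 'a \<Rightarrow> nat \<Rightarrow> 'a set" where
  "gball V E b r = {x \<in> V. gdist E x b \<le> r}"

definition ball_int :: "'a set \<Rightarrow> ('a \<Rightarrow> 'a \<Rightarrow> bool) \<Rightarrow> 'a \<Rightarrow> nat \<Rightarrow> 'a set" where
  "ball_int V E b r = {x \<in> gball V E b r. nbrs V E x \<subseteq> gball V E b r}"

(* An element of C(B_r, boundary of B_r) is represented by its extension by 0 to the whole type;
   this operator maps such functions to such functions, and on the interior only values
   on B_r enter. *)
definition dirichlet_laplacian ::
  "'a set \<Rightarrow> ('a \<Rightarrow> 'a \<Rightarrow> bool) \<Rightarrow> 'a \<Rightarrow> nat \<Rightarrow> ('a \<Rightarrow> real) \<Rightarrow> 'a \<Rightarrow> real" where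
  "dirichlet_laplacian V E b r f x = (if x \<in> ball_int V E b r then laplacian V E f x else 0)"

(* The exponential exp(- t A) of an operator A on real functions, given by its power series.
   On a finite-dimensional space of functions, as used below, the operator series converges,
   and its value on f is the pointwise sum. *)
definition exp_op :: "real \<Rightarrow> (('a \<Rightarrow> real) \<Rightarrow> 'a \<Rightarrow> real) \<Rightarrow> ('a \<Rightarrow> real) \<Rightarrow> 'a \<Rightarrow> real" where
  "exp_op t A f y = (\<Sum>n. (- t) ^ n / fact n * (A ^^ n) f y)"

definition dirichlet_heat_kernel ::
  "'a set \<Rightarrow> ('a \<Rightarrow> 'a \<Rightarrow> bool) \<Rightarrow> 'a \<Rightarrow> nat \<Rightarrow> real \<Rightarrow> 'a \<Rightarrow> 'a \<Rightarrow> real" where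
  "dirichlet_heat_kernel V E b r t x y =
     (if x \<in> ball_int V E b r \<and> y \<in> ball_int V E b r
      then exp_op t (dirichlet_laplacian V E b r) (indicator {x}) y
      else 0)"

(* b is the centre of the exhausting balls; the limit does not depend on it. *)
definition heat_kernel ::
  "'a set \<Rightarrow> ('a \<Rightarrow> 'a \<Rightarrow> bool) \<Rightarrow> 'a \<Rightarrow> real \<Rightarrow> 'a \<Rightarrow> 'a \<Rightarrow> real" where
  "heat_kernel V E b t x y = lim (\<lambda>r. dirichlet_heat_kernel V E b r t x y)"

(* Summability is required explicitly because infsum is 0 on non-summable families. *)
definition stochastically_incomplete ::
  "'a set \<Rightarrow> ('a \<Rightarrow> 'a \<Rightarrow> bool) \<Rightarrow> 'a \<Rightarrow> bool" where
  "stochastically_incomplete V E b \<longleftrightarrow>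
     (\<exists>x\<in>V. \<exists>t>0. heat_kernel V E b t x summable_on V \<and>
                    (\<Sum>\<^sub>\<infinity>y\<in>V. heat_kernel V E b t x y) < 1)"

end

theory Submission imports Defs begin

text \<open>
  Heat escapes to infinity because the hypothesis provides a function \<open>w \<ge> 0\<close> with
  \<open>\<Delta> w \<ge> 1\<close> on the whole graph (lemma \<open>ex_strictly_superharmonic\<close>). Probabilistically,
  \<open>w x\<close> then bounds the expected lifetime of the continuous time random walk started at \<open>x\<close>,
  so with positive probability the walk explodes before time \<open>T\<close>, for every \<open>T > w x\<close>.

  This is made precise on a finite domain \<open>U\<close> with its Dirichlet heat kernel \<open>p\<close>. The derivative of
  \<open>\<Sum>y\<in>U. (w y + t) * p\<^sub>t(x,y)\<close> is computed by moving the Laplacian from \<open>p\<close> to the weight: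
  cutting a nonnegative function off outside \<open>U\<close> can only increase its Laplacian inside \<open>U\<close>, so
  the term coming from \<open>w\<close> is at most \<open>- \<Sum>y\<in>U. p\<^sub>t(x,y)\<close>, the term coming from the constant
  weight \<open>t\<close> is at most \<open>0\<close>, and the explicit \<open>t\<close> contributes \<open>\<Sum>y\<in>U. p\<^sub>t(x,y)\<close>. The
  sum therefore decreases from its initial value \<open>w x\<close>, and \<open>T * (\<Sum>y\<in>U. p\<^sub>T(x,y)) \<le> w x\<close>
  (lemma \<open>heat_kernel_on_mass_bound\<close>). The bound does not depend on \<open>U\<close>, so it survives the
  limit along the exhausting balls, and \<open>T = w x + 1\<close> gives total mass below \<open>1\<close>.

  The argument needs \<open>p \<ge> 0\<close>, and the limit needs that \<open>p\<close> grows with \<open>U\<close>. Both follow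
  from one algebraic observation (lemma \<open>heat_kernel_on_mono\<close>): if \<open>M\<close> bounds the degrees, then
  \<open>exp(-t \<Delta>) = exp(-t M) * exp(t (M - \<Delta>))\<close>, and \<open>M - \<Delta>\<close> has nonnegative matrix entries
  that increase with the domain, hence so do all its powers.

  The function \<open>w\<close> is radial and decreasing in the distance from \<open>x\<^sub>0\<close>. If \<open>d r\<close> is its drop
  from the sphere of radius \<open>r\<close> to the next one, then \<open>\<Delta> w = m\<^sub>+ * d r - m\<^sub>- * d (r - 1)\<close> at
  radius \<open>r\<close>. Because \<open>m\<^sub>- \<ge> 1\<close> away from \<open>x\<^sub>0\<close>, it is enough that
  \<open>d r = a\<^sub>r * (1 + d (r - 1))\<close>, where \<open>a\<^sub>r\<close> is the ratio of the extremal values of \<open>m\<^sub>-\<close> and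
  \<open>m\<^sub>+\<close>. Summability of \<open>a\<close> makes \<open>d\<close> summable, so that \<open>w\<close>, the tail sum of \<open>d\<close>, is
  well defined and nonnegative.
\<close>

section \<open>Exponential power series\<close>

lemma exp_coeffs_summable:
  fixes c :: "nat \<Rightarrow> real"
  assumes "\<And>n. \<bar>c n\<bar> \<le> B * K ^ n"
  shows "summable (\<lambda>n. \<bar>t ^ n / fact n * c n\<bar>)"
proof (rule summable_comparison_test')
  have "summable (\<lambda>n. B * ((\<bar>t\<bar> * K) ^ n / fact n))"
    using summable_exp[of "\<bar>t\<bar> * K"] by (intro summable_mult) (simp add: field_simps)
  then show "summable (\<lambda>n. \<bar>t\<bar> ^ n / fact n * (B * K ^ n))"
    by (simp add: power_mult_distrib field_simps)
  show "norm \<bar>t ^ n / fact n * c n\<bar> \<le> \<bar>t\<bar> ^ n / fact n * (B * K ^ n)" for n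
    using mult_left_mono[OF assms[of n], of "\<bar>t\<bar> ^ n / fact n"]
    by (simp add: abs_mult power_abs)
qed

lemma exp_series_has_derivative:
  fixes c :: "nat \<Rightarrow> real"
  assumes "\<And>n. \<bar>c n\<bar> \<le> B * K ^ n"
  shows "((\<lambda>t. \<Sum>n. (- t) ^ n / fact n * c n) has_real_derivative
          - (\<Sum>n. (- t) ^ n / fact n * c (Suc n))) (at t)"
proof -
  define a where "a n = c n / fact n" for n
  have s: "summable (\<lambda>n. a n * z ^ n)" for z :: real
    using summable_rabs_cancel[OF exp_coeffs_summable[OF assms, of z]]
    by (simp add: a_def field_simps)
  have "((\<lambda>z. \<Sum>n. a n * z ^ n) has_real_derivative (\<Sum>n. diffs a n * (- t) ^ n)) (at (- t))"
    by (rule termdiffs_strong_converges_everywhere[OF s])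
  then have "((\<lambda>t. \<Sum>n. a n * (- t) ^ n) has_real_derivative (\<Sum>n. diffs a n * (- t) ^ n) * (- 1)) (at t)"
    by (rule DERIV_chain2) (auto intro!: derivative_eq_intros)
  moreover have "diffs a n = c (Suc n) / fact n" for n
    by (simp add: diffs_def a_def field_simps del: of_nat_Suc)
  ultimately show ?thesis
    by (simp add: a_def mult.commute)
qed

text \<open>
  The binomial theorem for \<open>(M - A)\<^sup>n\<close>: the scalar \<open>M\<close> commutes with \<open>A\<close>. Linearity enters
  only through finite sums, because the induction applies \<open>A\<close> to the expansion of the previous
  power.
\<close>

lemma power_of_shifted_operator:
  fixes A :: "('a \<Rightarrow> real) \<Rightarrow> 'a \<Rightarrow> real"
  assumes lin: "\<And>(a :: nat \<Rightarrow> real) g n. A (\<lambda>y. \<Sum>k\<le>n. a k * g k y) = (\<lambda>y. \<Sum>k\<le>n. a k * A (g k) y)"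
  shows "((\<lambda>f y. M * f y - A f y) ^^ n) f
         = (\<lambda>y. \<Sum>k\<le>n. (of_nat (n choose k) * M ^ (n - k) * (- 1) ^ k) * (A ^^ k) f y)"
proof (induction n)
  case 0
  then show ?case by simp
next
  case (Suc n)
  define b where "b n k = real (n choose k) * M ^ (n - k) * (- 1) ^ k" for n k
  have step: "((\<lambda>f y. M * f y - A f y) ^^ Suc n) f y
        = M * (\<Sum>k\<le>n. b n k * (A ^^ k) f y) - (\<Sum>k\<le>n. b n k * (A ^^ Suc k) f y)" for y
    using Suc lin[of "b n" "\<lambda>k. (A ^^ k) f" n] by (simp add: b_def)
  have pascal: "M * (\<Sum>k\<le>n. b n k * c k) - (\<Sum>k\<le>n. b n k * c (Suc k))
        = (\<Sum>k\<le>Suc n. b (Suc n) k * c k)" for c :: "nat \<Rightarrow> real"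
  proof -
    have b0: "b (Suc n) 0 = M * b n 0" by (simp add: b_def)
    have bS: "b (Suc n) (Suc k) = M * b n (Suc k) - b n k" if "k \<le> n" for k
    proof (cases "k = n")
      case True
      then show ?thesis by (simp add: b_def)
    next
      case False
      then have "n - k = Suc (n - Suc k)" using that by simp
      then show ?thesis by (simp add: b_def algebra_simps)
    qed
    have "(\<Sum>k\<le>Suc n. b (Suc n) k * c k)
          = M * b n 0 * c 0 + (\<Sum>k\<le>n. (M * b n (Suc k) - b n k) * c (Suc k))"
      by (subst sum.atMost_Suc_shift) (simp add: b0 bS)
    also have "\<dots> = M * (\<Sum>k\<le>Suc n. b n k * c k) - (\<Sum>k\<le>n. b n k * c (Suc k))"
      by (subst sum.atMost_Suc_shift)
         (simp add: sum_subtractf sum_distrib_left algebra_simps)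
    also have "b n (Suc n) = 0" by (simp add: b_def)
    then have "(\<Sum>k\<le>Suc n. b n k * c k) = (\<Sum>k\<le>n. b n k * c k)" by simp
    finally show ?thesis by simp
  qed
  show ?case
    using trans[OF step pascal[of "\<lambda>k. (A ^^ k) f y" for y]] by (intro ext) (simp only: b_def)
qed

text \<open>
  The identity \<open>exp(-t (M - A)) = exp(-t M) * exp(t A)\<close>, obtained as a Cauchy product of the two
  series at a fixed point \<open>y\<close>.
\<close>

lemma exp_op_shift:
  fixes A :: "('a \<Rightarrow> real) \<Rightarrow> 'a \<Rightarrow> real"
  assumes lin: "\<And>(a :: nat \<Rightarrow> real) g n. A (\<lambda>y. \<Sum>k\<le>n. a k * g k y) = (\<lambda>y. \<Sum>k\<le>n. a k * A (g k) y)"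
    and bound: "\<And>n. \<bar>(A ^^ n) f y\<bar> \<le> B * K ^ n"
  shows "exp_op t (\<lambda>f y. M * f y - A f y) f y
         = exp (- t * M) * (\<Sum>n. t ^ n / fact n * (A ^^ n) f y)"
proof -
  define p where "p n = t ^ n / fact n * (A ^^ n) f y" for n
  define q where "q n = (- t * M) ^ n / fact n" for n
  have coeff: "(- t) ^ n / fact n * (of_nat (n choose k) * M ^ (n - k) * (- 1) ^ k * c)
      = (t ^ k / fact k * c) * ((- t * M) ^ (n - k) / fact (n - k))"
    if "k \<le> n" for n k and c :: real
  proof -
    have "real (n choose k) / fact n = 1 / (fact k * fact (n - k))"
      using that by (simp add: binomial_fact)
    moreover have "(- t) ^ n * (- 1) ^ k = t ^ k * (- t) ^ (n - k)"
    proof -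
      have "(- t) ^ n = (- t) ^ k * (- t) ^ (n - k)"
        using that by (simp flip: power_add)
      then show ?thesis by (simp add: power_minus[of t k])
    qed
    ultimately have "(real (n choose k) / fact n) * ((- t) ^ n * (- 1) ^ k) * (M ^ (n - k) * c)
        = (1 / (fact k * fact (n - k))) * (t ^ k * (- t) ^ (n - k)) * (M ^ (n - k) * c)"
      by simp
    moreover have "(- t * M) ^ (n - k) = (- t) ^ (n - k) * M ^ (n - k)"
      by (rule power_mult_distrib)
    ultimately show ?thesis by (simp only: divide_inverse mult_ac inverse_mult_distrib mult_1)
  qed
  have "exp_op t (\<lambda>f y. M * f y - A f y) f y = (\<Sum>n. \<Sum>k\<le>n. p k * q (n - k))"
    unfolding exp_op_def power_of_shifted_operator[OF lin] p_def q_def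
    by (intro suminf_cong, subst sum_distrib_left, intro sum.cong refl, rule coeff) simp
  also have "\<dots> = (\<Sum>n. p n) * (\<Sum>n. q n)"
  proof (rule Cauchy_product[symmetric])
    show "summable (\<lambda>n. norm (p n))"
      using exp_coeffs_summable[of "\<lambda>n. (A ^^ n) f y", OF bound] by (simp add: p_def)
    show "summable (\<lambda>n. norm (q n))"
      using summable_norm_exp[of "- t * M"] by (simp add: q_def field_simps)
  qed
  also have "(\<Sum>n. q n) = exp (- t * M)"
    by (simp add: q_def exp_def field_simps scaleR_conv_of_real)
  finally show ?thesis by (simp add: p_def)
qed

section \<open>The Dirichlet heat flow on a finite domain\<close>

locale locally_finite_graph = simple_graph V E
  for V :: "'a set" and E :: "'a \<Rightarrow> 'a \<Rightarrow> bool" +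
  assumes locally_finite: "locally_finite V E"
begin

definition laplacian_on :: "'a set \<Rightarrow> ('a \<Rightarrow> real) \<Rightarrow> 'a \<Rightarrow> real" where
  "laplacian_on U f x = (if x \<in> U then laplacian V E f x else 0)"

definition heat_kernel_on :: "'a set \<Rightarrow> real \<Rightarrow> 'a \<Rightarrow> 'a \<Rightarrow> real" where
  "heat_kernel_on U t x = exp_op t (laplacian_on U) (indicator {x})"

text \<open>
  For \<open>M\<close> at least the degrees in \<open>U\<close>, this operator maps nonnegative functions to nonnegative
  ones. Outside \<open>U\<close> it is multiplication by \<open>M\<close>, so it preserves the functions supported in
  \<open>U\<close>.
\<close>

definition shifted :: "real \<Rightarrow> 'a set \<Rightarrow> ('a \<Rightarrow> real) \<Rightarrow> 'a \<Rightarrow> real" where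
  "shifted M U f y = M * f y - laplacian_on U f y"

definition degree_bound :: "real \<Rightarrow> 'a set \<Rightarrow> bool" where
  "degree_bound M U \<longleftrightarrow> 0 \<le> M \<and> (\<forall>x\<in>U. real (card (nbrs V E x)) \<le> M)"

lemma finite_nbrs: "finite (nbrs V E x)"
proof (cases "x \<in> V")
  case True
  then show ?thesis using locally_finite by (simp add: locally_finite_def)
next
  case False
  then have "nbrs V E x = {}" using adj_in_V by (auto simp: nbrs_def)
  then show ?thesis by simp
qed

lemma ex_degree_bound:
  assumes "finite U"
  obtains M where "degree_bound M U"
proof -
  define M where "M = (\<Sum>x\<in>U. real (card (nbrs V E x)))"
  have "real (card (nbrs V E x)) \<le> M" if "x \<in> U" for x
    unfolding M_def using that assms by (intro member_le_sum) auto
  moreover have "0 \<le> M" by (auto simp: M_def intro: sum_nonneg)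
  ultimately show ?thesis using that by (auto simp: degree_bound_def)
qed

lemma laplacian_on_bound:
  assumes "degree_bound M U" "\<And>y. \<bar>f y\<bar> \<le> B"
  shows "\<bar>laplacian_on U f x\<bar> \<le> 2 * M * B"
proof (cases "x \<in> U")
  case True
  have B: "0 \<le> B" using assms(2)[of x] by simp
  have "\<bar>laplacian V E f x\<bar> \<le> (\<Sum>y\<in>nbrs V E x. \<bar>f x - f y\<bar>)"
    unfolding laplacian_def by (rule sum_abs)
  also have "\<dots> \<le> (\<Sum>y\<in>nbrs V E x. 2 * B)"
    using abs_triangle_ineq4 assms(2) by (intro sum_mono) (smt (verit, best))
  also have "\<dots> \<le> M * (2 * B)"
    using assms(1) True B by (auto simp: degree_bound_def intro!: mult_right_mono)
  finally show ?thesis using True by (simp add: laplacian_on_def algebra_simps)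
next
  case False
  have "0 \<le> B" using assms(2)[of x] by simp
  then show ?thesis using assms(1) False by (simp add: laplacian_on_def degree_bound_def)
qed

lemma laplacian_on_power_bound:
  assumes "degree_bound M U" "\<And>y. \<bar>f y\<bar> \<le> B"
  shows "\<bar>(laplacian_on U ^^ n) f y\<bar> \<le> B * (2 * M) ^ n"
proof (induction n arbitrary: y)
  case 0
  then show ?case using assms by simp
next
  case (Suc n)
  then show ?case
    using laplacian_on_bound[OF assms(1), of "(laplacian_on U ^^ n) f" "B * (2 * M) ^ n"]
    by (simp add: algebra_simps)
qed

lemma shifted_power_bound:
  assumes "degree_bound M U" "\<And>y. \<bar>f y\<bar> \<le> B"
  shows "\<bar>(shifted M U ^^ n) f y\<bar> \<le> B * (3 * M) ^ n"
proof (induction n arbitrary: y)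
  case 0
  then show ?case using assms by simp
next
  case (Suc n)
  let ?g = "(shifted M U ^^ n) f"
  have "\<bar>laplacian_on U ?g y\<bar> \<le> 2 * M * (B * (3 * M) ^ n)"
    using laplacian_on_bound[OF assms(1) Suc.IH] .
  moreover have "\<bar>M * ?g y\<bar> \<le> M * (B * (3 * M) ^ n)"
    using Suc.IH[of y] assms(1) by (auto simp: degree_bound_def abs_mult intro!: mult_left_mono)
  moreover have "B * (3 * M) ^ Suc n = 3 * (M * (B * (3 * M) ^ n))" by simp
  moreover have "(shifted M U ^^ Suc n) f y = M * ?g y - laplacian_on U ?g y"
    by (simp add: shifted_def[of M U ?g])
  ultimately show ?case by linarith
qed

lemma laplacian_on_power_support:
  assumes "\<And>y. y \<notin> U \<Longrightarrow> f y = 0" "y \<notin> U"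
  shows "(laplacian_on U ^^ n) f y = 0"
  using assms by (cases n) (auto simp: laplacian_on_def)

lemma laplacian_eq_degree:
  "laplacian V E f x = real (card (nbrs V E x)) * f x - (\<Sum>y\<in>nbrs V E x. f y)"
  by (simp add: laplacian_def sum_subtractf)

lemma laplacian_on_linear:
  "laplacian_on U (\<lambda>y. \<Sum>k\<le>(n::nat). a k * g k y) = (\<lambda>y. \<Sum>k\<le>n. a k * laplacian_on U (g k) y)"
proof
  fix x
  have "(\<Sum>y\<in>nbrs V E x. \<Sum>k\<le>n. a k * g k y) = (\<Sum>k\<le>n. a k * (\<Sum>y\<in>nbrs V E x. g k y))"
    by (subst sum.swap) (simp add: sum_distrib_left)
  then show "laplacian_on U (\<lambda>y. \<Sum>k\<le>n. a k * g k y) x = (\<Sum>k\<le>n. a k * laplacian_on U (g k) x)"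
    by (simp add: laplacian_on_def laplacian_eq_degree sum_subtractf sum_distrib_left
        right_diff_distrib mult.left_commute)
qed

lemma shifted_linear:
  "shifted M U (\<lambda>y. \<Sum>k\<le>(n::nat). a k * g k y) = (\<lambda>y. \<Sum>k\<le>n. a k * shifted M U (g k) y)"
  by (auto simp: shifted_def laplacian_on_linear sum_distrib_left sum_subtractf[symmetric] algebra_simps
      intro!: sum.cong)

lemma heat_kernel_on_shifted:
  assumes "degree_bound M U"
  shows "heat_kernel_on U t x y
         = exp (- t * M) * (\<Sum>n. t ^ n / fact n * (shifted M U ^^ n) (indicator {x}) y)"
proof -
  have "(\<lambda>f y. M * f y - shifted M U f y) = laplacian_on U"
    by (simp add: shifted_def fun_eq_iff)
  moreover have "\<bar>indicator {x} y :: real\<bar> \<le> 1" for y by (simp add: indicator_def)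
  note shifted_power_bound[OF assms this]
  ultimately show ?thesis
    using exp_op_shift[of "shifted M U" "indicator {x}" y 1 "3 * M" t M, OF shifted_linear]
    by (simp add: heat_kernel_on_def)
qed

lemma shifted_outside: "y \<notin> U \<Longrightarrow> shifted M U f y = M * f y"
  by (simp add: shifted_def laplacian_on_def)

text \<open>
  Inside the domain the operator is
  \<open>f \<mapsto> (M - deg y) * f y + (\<Sum>z\<in>nbrs y. f z)\<close>, which has nonnegative coefficients that do not
  depend on the domain. At points outside \<open>U\<close> the smaller side vanishes with \<open>f\<close>.
\<close>

lemma shifted_mono:
  assumes "degree_bound M U'" "U \<subseteq> U'" "\<And>y. 0 \<le> f y" "\<And>y. f y \<le> g y" "\<And>y. y \<notin> U \<Longrightarrow> f y = 0"
  shows "0 \<le> shifted M U f y" "shifted M U f y \<le> shifted M U' g y"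
proof -
  let ?d = "real (card (nbrs V E y))"
  have s: "shifted M W h y = (M - ?d) * h y + (\<Sum>z\<in>nbrs V E y. h z)" if "y \<in> W" for W h
    using that by (simp add: shifted_def laplacian_on_def laplacian_eq_degree algebra_simps)
  note s' = shifted_outside[of y]
  have M: "0 \<le> M" using assms(1) by (simp add: degree_bound_def)
  have d: "?d \<le> M" if "y \<in> U'" using assms(1) that by (simp add: degree_bound_def)
  have g: "0 \<le> g z" for z using assms(3,4) order_trans by blast
  show "0 \<le> shifted M U f y"
    using s s' M d assms by (cases "y \<in> U") (auto intro!: sum_nonneg add_nonneg_nonneg)
  have "0 \<le> shifted M U' g y"
    using s s' M d g by (cases "y \<in> U'") (auto intro!: sum_nonneg add_nonneg_nonneg)
  moreover have "shifted M U f y \<le> shifted M U' g y" if "y \<in> U"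
    using s that assms d by (auto simp: subset_iff intro!: add_mono sum_mono mult_left_mono)
  ultimately show "shifted M U f y \<le> shifted M U' g y"
    using s'[of U M f] assms(5)[of y] by (cases "y \<in> U") auto
qed

text \<open>
  Positivity and domain monotonicity, termwise in the series of the nonnegative operator
  \<open>shifted\<close>. A degree bound of the larger domain serves both domains, so that the prefactors
  agree.
\<close>

lemma heat_kernel_on_mono:
  assumes "finite U'" "U \<subseteq> U'" "x \<in> U" "0 \<le> t"
  shows "0 \<le> heat_kernel_on U t x y" "heat_kernel_on U t x y \<le> heat_kernel_on U' t x y"
proof -
  obtain M where M': "degree_bound M U'" using ex_degree_bound[OF assms(1)] .
  then have M: "degree_bound M U" using assms(2) by (auto simp: degree_bound_def)
  let ?a = "\<lambda>W n y. (shifted M W ^^ n) (indicator {x}) y"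
  have a: "0 \<le> ?a U n y \<and> ?a U n y \<le> ?a U' n y \<and> (y \<notin> U \<longrightarrow> ?a U n y = 0)" for n y
  proof (induction n arbitrary: y)
    case 0
    then show ?case using assms(3) by (auto simp: indicator_def)
  next
    case (Suc n)
    then show ?case
      using shifted_mono[OF M' assms(2), of "?a U n" "?a U' n" y] shifted_outside[of y U M "?a U n"]
      by simp
  qed
  have s: "summable (\<lambda>n. t ^ n / fact n * ?a W n y)" if "degree_bound M W" for W
    by (rule summable_rabs_cancel[OF exp_coeffs_summable
          [OF shifted_power_bound[OF that, of "indicator {x}" 1]]]) (simp add: indicator_def)
  show "0 \<le> heat_kernel_on U t x y"
    unfolding heat_kernel_on_shifted[OF M]
    using a assms(4) by (intro mult_nonneg_nonneg suminf_nonneg s M) auto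
  show "heat_kernel_on U t x y \<le> heat_kernel_on U' t x y"
    unfolding heat_kernel_on_shifted[OF M] heat_kernel_on_shifted[OF M']
    using a assms(4) by (intro mult_left_mono suminf_le s M M') auto
qed

text \<open>
  Self-adjointness of the Dirichlet Laplacian. The weight \<open>w\<close> is cut off outside \<open>U\<close> because
  \<open>f\<close> vanishes there: an edge leaving \<open>U\<close> contributes to the left-hand side only through the
  degree of its inner end.
\<close>

lemma green_formula:
  assumes "finite U" "U \<subseteq> V" "\<And>y. y \<notin> U \<Longrightarrow> f y = 0"
  shows "(\<Sum>y\<in>U. w y * laplacian_on U f y) = (\<Sum>y\<in>U. laplacian_on U (\<lambda>z. indicator U z * w z) y * f y)"
proof -
  have r: "(\<Sum>z\<in>nbrs V E y. h z) = (\<Sum>z\<in>U. if E y z then h z else 0)"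
    if "\<And>z. z \<notin> U \<Longrightarrow> h z = 0" for h :: "'a \<Rightarrow> real" and y
  proof -
    have "(\<Sum>z\<in>U. if E y z then h z else 0) = (\<Sum>z\<in>U \<inter> {z. E y z}. h z)"
      using assms(1) by (simp add: sum.inter_restrict)
    also have "\<dots> = (\<Sum>z\<in>nbrs V E y. h z)"
      using assms(2) that finite_nbrs
      by (intro sum.mono_neutral_left) (auto simp: nbrs_def)
    finally show ?thesis by simp
  qed
  have "(\<Sum>y\<in>U. w y * (\<Sum>z\<in>U. if E y z then f z else 0))
      = (\<Sum>y\<in>U. \<Sum>z\<in>U. if E y z then w y * f z else 0)"
    by (auto simp: sum_distrib_left intro!: sum.cong)
  also have "\<dots> = (\<Sum>z\<in>U. \<Sum>y\<in>U. if E y z then w y * f z else 0)"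
    by (rule sum.swap)
  also have "\<dots> = (\<Sum>z\<in>U. (\<Sum>y\<in>U. if E z y then indicator U y * w y else 0) * f z)"
    using adj_sym by (auto simp: sum_distrib_right intro!: sum.cong)
  finally show ?thesis
    using r[of f] r[of "\<lambda>z. indicator U z * w z"] assms(3)
    by (simp add: laplacian_on_def laplacian_eq_degree algebra_simps sum_subtractf)
qed

text \<open>
  The heat equation, tested against a weight. Pairing with \<open>w\<close> first turns the series of
  operators into a scalar series; differentiation then shifts its coefficients by one
  application of the Laplacian, which the Green formula transfers to \<open>w\<close>.
\<close>

lemma heat_kernel_on_weighted_derivative:
  assumes "finite U" "U \<subseteq> V" "x \<in> U"
  shows "((\<lambda>t. \<Sum>y\<in>U. w y * heat_kernel_on U t x y) has_real_derivative
    - (\<Sum>y\<in>U. laplacian_on U (\<lambda>z. indicator U z * w z) y * heat_kernel_on U t x y)) (at t)"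
proof -
  obtain M where M: "degree_bound M U" using ex_degree_bound[OF assms(1)] .
  let ?a = "\<lambda>n y. (laplacian_on U ^^ n) (indicator {x}) y"
  have b: "\<bar>?a n y\<bar> \<le> 1 * (2 * M) ^ n" for n y
    by (intro laplacian_on_power_bound[OF M]) (simp add: indicator_def)
  have pairing: "(\<Sum>y\<in>U. v y * heat_kernel_on U t x y) = (\<Sum>n. (- t) ^ n / fact n * (\<Sum>y\<in>U. v y * ?a n y))"
    for v t
  proof -
    have s: "summable (\<lambda>n. (- t) ^ n / fact n * ?a n y)" for y
      by (rule summable_rabs_cancel[OF exp_coeffs_summable[OF b]])
    have "(\<Sum>y\<in>U. v y * heat_kernel_on U t x y) = (\<Sum>y\<in>U. \<Sum>n. v y * ((- t) ^ n / fact n * ?a n y))"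
      by (simp only: heat_kernel_on_def exp_op_def suminf_mult[OF s])
    also have "\<dots> = (\<Sum>n. \<Sum>y\<in>U. v y * ((- t) ^ n / fact n * ?a n y))"
      by (intro suminf_sum[symmetric] summable_mult s)
    finally show ?thesis by (simp add: sum_distrib_left mult.left_commute)
  qed
  have "\<bar>\<Sum>y\<in>U. w y * ?a n y\<bar> \<le> (\<Sum>y\<in>U. \<bar>w y\<bar>) * (2 * M) ^ n" for n
  proof -
    have "\<bar>\<Sum>y\<in>U. w y * ?a n y\<bar> \<le> (\<Sum>y\<in>U. \<bar>w y * ?a n y\<bar>)" by (rule sum_abs)
    also have "\<dots> \<le> (\<Sum>y\<in>U. \<bar>w y\<bar> * (2 * M) ^ n)"
      using b by (intro sum_mono) (auto simp: abs_mult intro!: mult_left_mono)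
    finally show ?thesis by (simp add: sum_distrib_right)
  qed
  note exp_series_has_derivative[OF this, of t]
  moreover have "(\<Sum>y\<in>U. w y * ?a (Suc n) y)
      = (\<Sum>y\<in>U. laplacian_on U (\<lambda>z. indicator U z * w z) y * ?a n y)" for n
    using green_formula[OF assms(1,2), of "?a n" w] laplacian_on_power_support[of U "indicator {x}"] assms(3)
    by (auto simp: indicator_def)
  ultimately show ?thesis by (simp add: pairing)
qed

text \<open>
  Replacing \<open>w y\<close> by \<open>0\<close> at the neighbours outside \<open>U\<close> increases each summand \<open>w x - w y\<close>.
\<close>

lemma laplacian_le_laplacian_on_restriction:
  assumes "\<And>y. 0 \<le> w y" "x \<in> U"
  shows "laplacian V E w x \<le> laplacian_on U (\<lambda>z. indicator U z * w z) x"
  using assms unfolding laplacian_on_def laplacian_def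
  by (auto intro!: sum_mono simp: indicator_def)

text \<open>
  The uniform loss of heat. The weight \<open>w\<close> alone would control only the time integral of the
  total mass; adding the weight \<open>t\<close> also uses that the mass decreases, and gives a bound at the
  single time \<open>T\<close>.
\<close>

lemma heat_kernel_on_mass_bound:
  assumes "finite U" "U \<subseteq> V" "x \<in> U" "0 \<le> T"
    and w: "\<And>y. 0 \<le> w y" "\<And>y. y \<in> V \<Longrightarrow> 1 \<le> laplacian V E w y"
  shows "T * (\<Sum>y\<in>U. heat_kernel_on U T x y) \<le> w x"
proof -
  let ?p = "heat_kernel_on U"
  let ?L = "\<lambda>w. laplacian_on U (\<lambda>z. indicator U z * w z)"
  \<comment> \<open>The factors \<open>1 *\<close> present the total mass as a pairing with the constant weight.\<close>
  define G where "G t = (\<Sum>y\<in>U. w y * ?p t x y) + t * (\<Sum>y\<in>U. 1 * ?p t x y)" for t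
  define G' where "G' t = - (\<Sum>y\<in>U. ?L w y * ?p t x y)
      + (1 * (\<Sum>y\<in>U. 1 * ?p t x y) + - (\<Sum>y\<in>U. ?L (\<lambda>_. 1) y * ?p t x y) * t)" for t
  have p: "0 \<le> ?p t x y" if "0 \<le> t" for t y
    using heat_kernel_on_mono(1)[OF assms(1) order_refl assms(3) that] .
  have "(G has_real_derivative G' t) (at t)" for t
    unfolding G_def G'_def
    by (intro DERIV_add DERIV_mult DERIV_ident heat_kernel_on_weighted_derivative assms)
  moreover have "G' t \<le> 0" if t: "0 \<le> t" for t
  proof -
    have "1 \<le> ?L w y" if "y \<in> U" for y
      using order_trans[OF w(2) laplacian_le_laplacian_on_restriction[OF w(1) that]] assms(2) that
      by blast
    then have "(\<Sum>y\<in>U. 1 * ?p t x y) \<le> (\<Sum>y\<in>U. ?L w y * ?p t x y)"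
      using p[OF t] by (intro sum_mono mult_right_mono) auto
    moreover have "0 \<le> (\<Sum>y\<in>U. ?L (\<lambda>_. 1) y * ?p t x y) * t"
      using laplacian_le_laplacian_on_restriction[of "\<lambda>_. 1" _ U] p[OF t]
      by (intro sum_nonneg mult_nonneg_nonneg t) (auto simp: laplacian_def)
    ultimately show ?thesis by (simp add: G'_def)
  qed
  ultimately have "G T \<le> G 0"
    using assms(4) by (intro DERIV_nonpos_imp_nonincreasing[of 0 T G]) auto
  moreover have "?p 0 x y = indicator {x} y" for y
    using suminf_finite[of "{0}" "\<lambda>n. (- 0) ^ n / fact n * (laplacian_on U ^^ n) (indicator {x}) y"]
    by (simp add: heat_kernel_on_def exp_op_def)
  then have "G 0 = w x"
    using assms(1,3) by (simp add: G_def indicator_def if_distrib sum.delta cong: if_cong)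
  moreover have "0 \<le> (\<Sum>y\<in>U. w y * ?p T x y)"
    using w(1) p[OF assms(4)] by (intro sum_nonneg) auto
  ultimately show ?thesis by (simp add: G_def)
qed

end

section \<open>The increments of the radial function\<close>

text \<open>
  The increment at radius \<open>Suc n\<close> uses \<open>a n\<close>, so \<open>a n\<close> stands for the ratio of the extremal
  numbers of neighbours on the sphere of radius \<open>Suc n\<close>. The value \<open>1\<close> at radius \<open>0\<close> suffices
  because the centre has at least one neighbour.
\<close>

definition radial_increment :: "(nat \<Rightarrow> real) \<Rightarrow> nat \<Rightarrow> real" where
  "radial_increment a = rec_nat 1 (\<lambda>n d. a n * (1 + d))"

lemma radial_increment_simps [simp]:
  "radial_increment a 0 = 1"
  "radial_increment a (Suc n) = a n * (1 + radial_increment a n)"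
  by (simp_all add: radial_increment_def)

lemma radial_increment_nonneg:
  assumes "\<And>n. 0 \<le> a n"
  shows "0 \<le> radial_increment a n"
  using assms by (induction n) auto

text \<open>
  The recursion gives \<open>1 + d (n + 1) \<le> (1 + a n) * (1 + d n)\<close>, so \<open>1 + d\<close> is at most twice the
  product of the \<open>1 + a k\<close>, which converges together with the sum of \<open>a\<close>. Bounded \<open>d\<close> then makes
  \<open>d (n + 1)\<close> at most a constant times \<open>a n\<close>.
\<close>

lemma summable_radial_increment:
  assumes "\<And>n. 0 \<le> a n" "summable a"
  shows "summable (radial_increment a)"
proof -
  let ?d = "radial_increment a"
  have "1 + ?d n \<le> 2 * exp (\<Sum>k<n. a k)" for n
  proof (induction n)
    case 0
    then show ?case by simp
  next
    case (Suc n)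
    have "1 + ?d (Suc n) \<le> (1 + a n) * (1 + ?d n)"
      using radial_increment_nonneg[of a n] assms(1) by (simp add: algebra_simps)
    also have "\<dots> \<le> exp (a n) * (2 * exp (\<Sum>k<n. a k))"
      using Suc radial_increment_nonneg[of a n] assms(1) by (intro mult_mono) auto
    finally show ?case by (simp add: exp_add mult_ac)
  qed
  moreover have "(\<Sum>k<n. a k) \<le> suminf a" for n
    using assms by (intro sum_le_suminf) auto
  ultimately have K: "1 + ?d n \<le> 2 * exp (suminf a)" for n
    by (smt (verit, best) exp_le_cancel_iff)
  have "summable (\<lambda>n. ?d (Suc n))"
  proof (rule summable_comparison_test')
    show "summable (\<lambda>n. a n * (2 * exp (suminf a)))" using assms(2) by (rule summable_mult2)
    show "norm (?d (Suc n)) \<le> a n * (2 * exp (suminf a))" for n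
      using mult_left_mono[OF K assms(1)] assms(1) radial_increment_nonneg[of a n] by (simp add: abs_mult)
  qed
  then show ?thesis by (simp only: summable_Suc_iff)
qed

section \<open>Distances and radial functions\<close>

locale connected_locally_finite_graph = locally_finite_graph V E
  for V :: "'a set" and E :: "'a \<Rightarrow> 'a \<Rightarrow> bool" +
  assumes connected: "connected_graph V E"
begin

lemma gdist_path:
  assumes "x \<in> V" "y \<in> V"
  shows "(E ^^ gdist E x y) x y"
proof -
  have "E\<^sup>*\<^sup>* x y" using connected assms by (simp add: connected_graph_def)
  then obtain n where "(E ^^ n) x y" by (auto simp: rtranclp_power)
  then show ?thesis unfolding gdist_def by (rule LeastI)
qed

lemma gdist_le: "(E ^^ n) x y \<Longrightarrow> gdist E x y \<le> n"
  unfolding gdist_def by (rule Least_le)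

lemma gdist_eq_0:
  assumes "x \<in> V" "y \<in> V"
  shows "gdist E x y = 0 \<longleftrightarrow> x = y"
  using gdist_path[OF assms] gdist_le[of 0 x y] by auto

lemma gdist_adjacent:
  assumes "E x y" "z \<in> V"
  shows "gdist E x z \<le> Suc (gdist E y z)"
  using assms gdist_path[of y z] adj_in_V by (intro gdist_le relpowp_Suc_I2) auto

lemma ex_closer_neighbour:
  assumes "x \<in> V" "z \<in> V" "gdist E x z = Suc n"
  obtains y where "y \<in> nbrs V E x" "gdist E y z = n"
proof -
  have "(E ^^ Suc n) x z" using gdist_path[OF assms(1,2)] assms(3) by simp
  then obtain y where y: "E x y" "(E ^^ n) y z" by (rule relpowp_Suc_E2)
  then have "gdist E y z = n"
    using gdist_le[of n y z] gdist_adjacent[OF y(1) assms(2)] assms(3) by simp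
  then show ?thesis using that y adj_in_V by (auto simp: nbrs_def)
qed

lemma finite_gball:
  assumes "z \<in> V"
  shows "finite (gball V E z r)"
proof (induction r)
  case 0
  have "gball V E z 0 \<subseteq> {z}" using gdist_eq_0 assms by (auto simp: gball_def)
  then show ?case by (rule finite_subset) simp
next
  case (Suc r)
  have "gball V E z (Suc r) \<subseteq> gball V E z r \<union> (\<Union>y\<in>gball V E z r. nbrs V E y)"
  proof
    fix x assume "x \<in> gball V E z (Suc r)"
    then have x: "x \<in> V" "gdist E x z \<le> r \<or> gdist E x z = Suc r" by (auto simp: gball_def)
    show "x \<in> gball V E z r \<union> (\<Union>y\<in>gball V E z r. nbrs V E y)"
    proof (cases "gdist E x z \<le> r")
      case True
      then show ?thesis using x by (simp add: gball_def)
    next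
      case False
      then obtain y where "y \<in> nbrs V E x" "gdist E y z = r"
        using ex_closer_neighbour x assms by blast
      then show ?thesis using adj_sym adj_in_V by (auto simp: gball_def nbrs_def)
    qed
  qed
  then show ?case using Suc finite_nbrs by (auto intro: finite_subset)
qed

lemma finite_gsphere:
  assumes "z \<in> V"
  shows "finite (gsphere V E z r)"
  using finite_gball[OF assms, of r] by (rule finite_subset[rotated]) (auto simp: gsphere_def gball_def)

text \<open>
  Distances to \<open>x0\<close> change by at most one along an edge, and edges within a sphere contribute
  nothing. For \<open>x = x0\<close> the truncated index \<open>0 - 1\<close> is harmless, as \<open>m_minus\<close> vanishes there.
\<close>

lemma laplacian_radial:
  fixes W d :: "nat \<Rightarrow> real"
  assumes "x0 \<in> V" "x \<in> V" and d: "\<And>n. W n - W (Suc n) = d n"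
  shows "laplacian V E (\<lambda>y. W (gdist E y x0)) x
         = m_plus V E x0 x * d (gdist E x x0) - m_minus V E x0 x * d (gdist E x x0 - 1)"
proof -
  let ?\<rho> = "\<lambda>y. gdist E y x0"
  have "W (?\<rho> x) - W (?\<rho> y)
      = (if ?\<rho> y = Suc (?\<rho> x) then d (?\<rho> x) else 0) - (if Suc (?\<rho> y) = ?\<rho> x then d (?\<rho> x - 1) else 0)"
    if "y \<in> nbrs V E x" for y
  proof -
    have "E x y" "E y x" using that adj_sym by (auto simp: nbrs_def)
    then have "?\<rho> x \<le> Suc (?\<rho> y)" "?\<rho> y \<le> Suc (?\<rho> x)" using gdist_adjacent assms(1) by blast+
    then consider "?\<rho> y = Suc (?\<rho> x)" | "?\<rho> y = ?\<rho> x" | "?\<rho> x = Suc (?\<rho> y)" by linarith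
    then show ?thesis using d[of "?\<rho> x"] d[of "?\<rho> y"] by cases auto
  qed
  then have "laplacian V E (\<lambda>y. W (?\<rho> y)) x
      = (\<Sum>y\<in>nbrs V E x. if ?\<rho> y = Suc (?\<rho> x) then d (?\<rho> x) else 0)
        - (\<Sum>y\<in>nbrs V E x. if Suc (?\<rho> y) = ?\<rho> x then d (?\<rho> x - 1) else 0)"
    by (simp add: laplacian_def flip: sum_subtractf)
  then show ?thesis
    by (simp add: m_plus_def m_minus_def finite_nbrs flip: sum.inter_filter)
qed

text \<open>
  The radial function whose increments satisfy the recursion above. At radius \<open>n + 1\<close> the
  recursion turns \<open>m_plus * d (n + 1)\<close> into at least \<open>m_minus * (1 + d n)\<close>, and the extra
  \<open>m_minus\<close> is at least \<open>1\<close> because a shortest path to \<open>x0\<close> passes through the previous sphere.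
\<close>

lemma ex_strictly_superharmonic:
  assumes "infinite V" "x0 \<in> V"
    and pos: "\<And>r. r \<ge> 1 \<Longrightarrow> m_plus_min V E x0 r > 0"
    and summable: "summable (\<lambda>r. real (m_minus_max V E x0 (Suc r)) / real (m_plus_min V E x0 (Suc r)))"
  obtains w where "\<And>y. 0 \<le> w y" "\<And>y. y \<in> V \<Longrightarrow> 1 \<le> laplacian V E w y"
proof -
  define a where "a r = real (m_minus_max V E x0 (Suc r)) / real (m_plus_min V E x0 (Suc r))" for r
  define d where "d = radial_increment a"
  define W where "W n = suminf d - (\<Sum>k<n. d k)" for n
  have a: "0 \<le> a n" for n by (simp add: a_def)
  have d: "0 \<le> d n" for n using radial_increment_nonneg[of a] a by (simp add: d_def)
  have "summable d"
    unfolding d_def using a summable by (intro summable_radial_increment) (simp_all add: a_def[abs_def])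
  then have W: "0 \<le> W n" for n using d by (auto simp: W_def intro: sum_le_suminf)
  have "1 \<le> laplacian V E (\<lambda>y. W (gdist E y x0)) x" if x: "x \<in> V" for x
  proof (cases "gdist E x x0")
    case 0
    then have [simp]: "x = x0" using gdist_eq_0 x assms(2) by simp
    obtain v where v: "v \<in> V" "v \<noteq> x0"
      using assms(1) by (metis finite.emptyI finite_insert finite_subset insertI1 subsetI)
    then have "E\<^sup>*\<^sup>* x0 v" using connected assms(2) by (simp add: connected_graph_def)
    then obtain y where y: "E x0 y" using v(2) by (metis converse_rtranclpE)
    have yV: "y \<in> V" "y \<noteq> x0" using y adj_in_V adj_irrefl by auto
    have "gdist E y x0 = 1"
      using gdist_adjacent[OF adj_sym[OF y] assms(2)] gdist_eq_0[OF yV(1) assms(2)] yV(2) 0 by simp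
    then have "y \<in> {y \<in> nbrs V E x. gdist E y x0 = Suc (gdist E x x0)}"
      using y yV 0 by (simp add: nbrs_def)
    then have "{y \<in> nbrs V E x. gdist E y x0 = Suc (gdist E x x0)} \<noteq> {}" by blast
    then have "0 < m_plus V E x0 x"
      unfolding m_plus_def using finite_nbrs by (simp only: card_gt_0_iff) simp
    moreover have "m_minus V E x0 x = 0" using 0 by (simp add: m_minus_def)
    ultimately show ?thesis
      using laplacian_radial[OF assms(2) x, of W d] 0 by (simp add: W_def d_def)
  next
    case (Suc n)
    have xs: "x \<in> gsphere V E x0 (Suc n)" using x Suc by (simp add: gsphere_def)
    have min: "m_plus_min V E x0 (Suc n) \<le> m_plus V E x0 x"
      unfolding m_plus_min_def using xs finite_gsphere[OF assms(2)] by (intro Min_le) auto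
    have max: "m_minus V E x0 x \<le> m_minus_max V E x0 (Suc n)"
      unfolding m_minus_max_def using xs finite_gsphere[OF assms(2)] by (intro Max_ge) auto
    obtain y where "y \<in> nbrs V E x" "gdist E y x0 = n"
      using ex_closer_neighbour[OF x assms(2) Suc] .
    then have "{y \<in> nbrs V E x. Suc (gdist E y x0) = gdist E x x0} \<noteq> {}" using Suc by auto
    then have "0 < m_minus V E x0 x"
      unfolding m_minus_def using finite_nbrs by (simp only: card_gt_0_iff) simp
    then have one: "1 \<le> real (m_minus V E x0 x)" by simp
    have "1 + m_minus V E x0 x * d n \<le> m_minus V E x0 x * (1 + d n)"
      using one by (simp add: algebra_simps)
    also have "\<dots> \<le> m_minus_max V E x0 (Suc n) * (1 + d n)"
      using max d by (intro mult_right_mono) auto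
    also have "\<dots> = m_plus_min V E x0 (Suc n) * d (Suc n)"
      using pos[of "Suc n"] by (simp add: d_def a_def)
    also have "\<dots> \<le> m_plus V E x0 x * d (Suc n)"
      using min d by (intro mult_right_mono) auto
    finally show ?thesis
      using laplacian_radial[OF assms(2) x, of W d] Suc by (simp add: W_def)
  qed
  with W show ?thesis using that[of "\<lambda>y. W (gdist E y x0)"] by blast
qed

section \<open>Exhaustion by balls\<close>

lemma dirichlet_heat_kernel_eq:
  "dirichlet_heat_kernel V E b r t x y =
     (if x \<in> ball_int V E b r \<and> y \<in> ball_int V E b r then heat_kernel_on (ball_int V E b r) t x y else 0)"
proof -
  have "dirichlet_laplacian V E b r = laplacian_on (ball_int V E b r)"
    by (simp add: fun_eq_iff dirichlet_laplacian_def laplacian_on_def)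
  then show ?thesis by (simp add: dirichlet_heat_kernel_def heat_kernel_on_def)
qed

lemma finite_ball_int: "b \<in> V \<Longrightarrow> finite (ball_int V E b r)"
  using finite_gball[of b r] by (auto simp: ball_int_def)

lemma ball_int_subset: "ball_int V E b r \<subseteq> V"
  by (auto simp: ball_int_def gball_def)

lemma ball_int_mono: "r \<le> s \<Longrightarrow> ball_int V E b r \<subseteq> ball_int V E b s"
  by (fastforce simp: ball_int_def gball_def)

lemma dirichlet_heat_kernel_nonneg:
  assumes "b \<in> V" "0 \<le> t"
  shows "0 \<le> dirichlet_heat_kernel V E b r t x y"
  using heat_kernel_on_mono(1)[OF finite_ball_int[OF assms(1)] order_refl _ assms(2)]
  by (simp add: dirichlet_heat_kernel_eq)

lemma incseq_dirichlet_heat_kernel: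
  assumes "b \<in> V" "0 \<le> t"
  shows "incseq (\<lambda>r. dirichlet_heat_kernel V E b r t x y)"
  unfolding incseq_def
proof (intro allI impI)
  fix r s :: nat assume "r \<le> s"
  note sub = ball_int_mono[OF this, of b]
  show "dirichlet_heat_kernel V E b r t x y \<le> dirichlet_heat_kernel V E b s t x y"
  proof (cases "x \<in> ball_int V E b r \<and> y \<in> ball_int V E b r")
    case True
    then show ?thesis
      using sub heat_kernel_on_mono(2)[OF finite_ball_int[OF assms(1)] sub _ assms(2)]
      by (auto simp: dirichlet_heat_kernel_eq)
  next
    case False
    then have "dirichlet_heat_kernel V E b r t x y = 0" by (simp only: dirichlet_heat_kernel_eq if_False)
    then show ?thesis using dirichlet_heat_kernel_nonneg[OF assms] by simp
  qed
qed

text \<open>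
  The uniform bound on finite domains serves twice: it forces the increasing sequence of Dirichlet
  kernels to converge, so that \<open>lim\<close> denotes a true limit, and it passes to finite partial sums
  of the heat kernel.
\<close>

lemma heat_kernel_mass_bound:
  assumes b: "b \<in> V" and t: "0 < t"
    and w: "\<And>y. 0 \<le> w y" "\<And>y. y \<in> V \<Longrightarrow> 1 \<le> laplacian V E w y"
  shows "heat_kernel V E b t x summable_on V"
    and "(\<Sum>\<^sub>\<infinity>y\<in>V. heat_kernel V E b t x y) \<le> w x / t"
proof -
  let ?p = "\<lambda>r. dirichlet_heat_kernel V E b r t x"
  have p: "0 \<le> ?p r y" for r y using dirichlet_heat_kernel_nonneg b t by simp
  have mass: "(\<Sum>y\<in>F. ?p r y) \<le> w x / t" if "finite F" for F r
  proof (cases "x \<in> ball_int V E b r")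
    case True
    let ?U = "ball_int V E b r"
    have fin: "finite ?U" using finite_ball_int[OF b] .
    have "(\<Sum>y\<in>F. ?p r y) \<le> (\<Sum>y\<in>F \<union> ?U. ?p r y)"
      using fin that p by (intro sum_mono2) auto
    also have "\<dots> = (\<Sum>y\<in>?U. ?p r y)"
      using fin that by (intro sum.mono_neutral_right) (auto simp: dirichlet_heat_kernel_eq)
    also have "\<dots> = (\<Sum>y\<in>?U. heat_kernel_on ?U t x y)"
      using True by (intro sum.cong) (auto simp: dirichlet_heat_kernel_eq)
    also have "\<dots> \<le> w x / t"
      using heat_kernel_on_mass_bound[OF fin ball_int_subset True _ w] t
      by (simp add: field_simps)
    finally show ?thesis .
  next
    case False
    then show ?thesis using w(1)[of x] t by (simp add: dirichlet_heat_kernel_eq)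
  qed
  have lim: "(\<lambda>r. ?p r y) \<longlonglongrightarrow> heat_kernel V E b t x y" for y
  proof -
    have "incseq (\<lambda>r. ?p r y)" using incseq_dirichlet_heat_kernel[OF b] t by simp
    moreover have "\<forall>r. ?p r y \<le> w x / t" using mass[of "{y}"] by simp
    ultimately obtain l where "(\<lambda>r. ?p r y) \<longlonglongrightarrow> l" by (rule incseq_convergent)
    then have "convergent (\<lambda>r. ?p r y)" by (rule convergentI)
    then show ?thesis by (simp add: convergent_LIMSEQ_iff heat_kernel_def)
  qed
  have nonneg: "0 \<le> heat_kernel V E b t x y" for y
    using lim[of y] p by (intro LIMSEQ_le_const) auto
  have bound: "sum (heat_kernel V E b t x) F \<le> w x / t" if "finite F" for F
    using mass[OF that] by (intro LIMSEQ_le_const2[OF tendsto_sum[OF lim]]) auto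
  show "heat_kernel V E b t x summable_on V"
    using nonneg bound by (intro nonneg_bdd_above_summable_on) (auto simp: bdd_above_def)
  then show "(\<Sum>\<^sub>\<infinity>y\<in>V. heat_kernel V E b t x y) \<le> w x / t"
    using bound by (intro infsum_le_finite_sums) auto
qed

end

theorem theorem3p6:
  fixes V :: "'a set" and E :: "'a \<Rightarrow> 'a \<Rightarrow> bool" and x0 b :: 'a
  assumes "simple_graph V E"
    and "infinite V"
    and "locally_finite V E"
    and "connected_graph V E"
    and "b \<in> V"
    and "x0 \<in> V"
    and "\<And>r. r \<ge> 1 \<Longrightarrow> m_plus_min V E x0 r > 0"
    and "summable (\<lambda>r. real (m_minus_max V E x0 (Suc r)) / real (m_plus_min V E x0 (Suc r)))"
  shows "stochastically_incomplete V E b"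
proof -
  interpret simple_graph V E by fact
  interpret connected_locally_finite_graph V E
    by unfold_locales (fact assms)+
  obtain w where w: "\<And>y. 0 \<le> w y" "\<And>y. y \<in> V \<Longrightarrow> 1 \<le> laplacian V E w y"
    using ex_strictly_superharmonic[OF assms(2,6-8)] by blast
  have t: "0 < w b + 1" using w(1)[of b] by simp
  have "w b / (w b + 1) < 1" using t by simp
  then show ?thesis
    unfolding stochastically_incomplete_def
    using heat_kernel_mass_bound[OF assms(5) t w, of b] assms(5) t by (meson le_less_trans)
qed

end
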